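(* Let $\mathcal{D}_{n,s}$ be an orthogonally structured positive basis of $\mathbb{R}^n$ and let $\mathcal{D}_{\mathbb{L}_1},\dots,\mathcal{D}_{\mathbb{L}_s}$ be a decomposition of $\mathcal{D}_{n,s}$ into minimal positive bases of pairwise orthogonal subspaces $\mathbb{L}_1,\dots,\mathbb{L}_s$. Assume that $\dim(\mathbb{L}_i)>1$ for every $i\in\{1,\dots,s\}$. Let $k\ge1$ and, for every $i\in\{1,\dots,s\}$, let $\mathbf{R}^{(1)}_{\mathbb{L}_i},\dots,\mathbf{R}^{(k)}_{\mathbb{L}_i}$ be $k$ rotation matrices in $\mathbb{R}^{n\times n}$ satisfying properties (i), (ii) and (iii) (stated in the context) relative to $\mathcal{D}_{\mathbb{L}_i}$. Let $\mathcal{D}^{(j)}_{\mathbb{L}_i}$ denote the family obtained by applying $\mathbf{R}^{(j)}_{\mathbb{L}_i}$ to each vector of $\mathcal{D}_{\mathbb{L}_i}$. Then the set $$\mathcal{D}^{(1:k)}_{n,s}=\bigcup_{j=1}^k\mathcal{D}^{(j)}_{n,s},\qquad\text{with}\quad\mathcal{D}^{(j)}_{n,s}=\bigcup_{i=1}^s\mathcal{D}^{(j)}_{\mathbb{L}_i}\quad\text{for all }j\in\{1,\dots,k\},$$ is a positive $k$-basis of $\mathbb{R}^n$ with $\mathrm{cm}_k\left(\mathcal{D}^{(1:k)}_{n,s}\right)\ge\mathrm{cm}(\mathcal{D}_{n,s})$.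
   Context: Throughout, $n\ge2$. Families of vectors may contain repetitions. Positive spanning sets are finite families of nonzero vectors. For a linear subspace $\mathbb{L}$ of $\mathbb{R}^n$ and a finite family $\mathcal{D}$ in $\mathbb{L}$, $\mathrm{pspan}(\mathcal{D})$ is the set of all linear combinations of elements of $\mathcal{D}$ with nonnegative coefficients; $\mathcal{D}$ is a positive spanning set of $\mathbb{L}$ if $\mathrm{pspan}(\mathcal{D})=\mathbb{L}$. A positive basis of $\mathbb{L}$ is a positive spanning set $\mathcal{D}$ of $\mathbb{L}$ such that $\mathrm{pspan}(\mathcal{D}\setminus\{\mathbf{d}\})\neq\mathbb{L}$ for every $\mathbf{d}\in\mathcal{D}$ (where $\mathcal{D}\setminus\{\mathbf{d}\}$ removes exactly one instance of $\mathbf{d}$). It is minimal if it has exactly $\dim(\mathbb{L})+1$ elements. A positive basis $\mathcal{D}_{n,s}$ of $\mathbb{R}^n$ with $n+s$ elements is an orthogonally structured positive basis (OSPB) if there exist pairwise orthogonal subspaces $\mathbb{L}_1,\dots,\mathbb{L}_s$ of $\mathbb{R}^n$ with $\mathbb{R}^n=\mathbb{L}_1+\cdots+\mathbb{L}_s$ and minimal positive bases $\mathcal{D}_{\mathbb{L}_i}$ of $\mathbb{L}_i$ such that $\mathcal{D}_{n,s}=\mathcal{D}_{\mathbb{L}_1}\cup\cdots\cup\mathcal{D}_{\mathbb{L}_s}$; such a family $\mathcal{D}_{\mathbb{L}_1},\dots,\mathcal{D}_{\mathbb{L}_s}$ is a decomposition of $\mathcal{D}_{n,s}$. Properties (i),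 (ii), (iii) relative to a minimal positive basis: let $\mathcal{D}_{\mathbb{L}}=\{\mathbf{d}_1,\dots,\mathbf{d}_{\ell+1}\}$ be a minimal positive basis of an $\ell$-dimensional subspace $\mathbb{L}$ of $\mathbb{R}^n$, $\ell\ge2$. For some vectors $\mathbf{v}_1,\dots,\mathbf{v}_{\ell+1}\in\mathbb{L}$ satisfying $\mathbf{d}_i^\top\mathbf{v}_i>0$ for all $i\in\{1,\dots,\ell+1\}$ and $\mathbf{d}_i^\top\mathbf{v}_j<0$ for all $1\le j<i\le\ell+1$, let $\mathbf{d}_{i,i'}$ be the orthogonal projection of $\mathbf{d}_i$ on $\mathbb{L}\cap\{\mathbf{v}_{i'}\}^\perp$ for any $(i,i')\in\{1,\dots,\ell+1\}^2$, and let $$\rho_{\mathcal{D}_{\mathbb{L}}}=\max_{i,i'\le\ell+1}\frac{\mathbf{d}_i^\top\mathbf{d}_{i,i'}}{\|\mathbf{d}_i\|\,\|\mathbf{d}_{i,i'}\|}.$$ The properties required of rotation matrices $\mathbf{R}^{(1)}_{\mathbb{L}},\dots,\mathbf{R}^{(k)}_{\mathbb{L}}\in\mathbb{R}^{n\times n}$ relative to $\mathcal{D}_{\mathbb{L}}$ are: (i) $\mathbf{R}^{(j)}_{\mathbb{L}}\mathbf{u}=\mathbf{u}$ for any $j\in\{1,\dots,k\}$ and any $\mathbf{u}\in\mathbb{L}^\perp$; (ii) for any $(j,j')\in\{1,\dots,k\}^2$ and any $(i,i')\in\{1,\dots,\ell+1\}^2$, $\dfrac{[\mathbf{R}^{(j)}_{\mathbb{L}}\mathbf{d}_i]^\top\mathbf{R}^{(j')}_{\mathbb{L}}\mathbf{d}_{i'}}{\|\mathbf{R}^{(j)}_{\mathbb{L}}\mathbf{d}_i\|\,\|\mathbf{R}^{(j')}_{\mathbb{L}}\mathbf{d}_{i'}\|}=1$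 if and only if $j=j'$ and $i=i'$; (iii) $\dfrac{[\mathbf{R}^{(j)}_{\mathbb{L}}\mathbf{d}_i]^\top\mathbf{d}_i}{\|\mathbf{R}^{(j)}_{\mathbb{L}}\mathbf{d}_i\|\,\|\mathbf{d}_i\|}>\rho_{\mathcal{D}_{\mathbb{L}}}$ for any $(i,j)\in\{1,\dots,\ell+1\}\times\{1,\dots,k\}$. For $k\ge1$ and a finite family $\mathcal{D}$ in $\mathbb{R}^n$, $\mathrm{pspan}_k(\mathcal{D})$ is the intersection of $\mathrm{pspan}(\mathcal{S})$ over all subfamilies $\mathcal{S}\subset\mathcal{D}$ with $|\mathcal{S}|\ge|\mathcal{D}|-k+1$. $\mathcal{D}$ is a positive $k$-spanning set of $\mathbb{R}^n$ if $\mathrm{pspan}_k(\mathcal{D})=\mathbb{R}^n$, and a positive $k$-basis of $\mathbb{R}^n$ if moreover $\mathrm{pspan}_k(\mathcal{D}\setminus\{\mathbf{d}\})\ne\mathbb{R}^n$ for every $\mathbf{d}\in\mathcal{D}$. For a finite family $\mathcal{D}$ of nonzero vectors in $\mathbb{R}^n$ and $1\le k\le|\mathcal{D}|$, the $k$-cosine measure and the cosine measure (for $\mathcal{D}$ nonempty) are $$\mathrm{cm}_k(\mathcal{D})=\min_{\mathbf{u}\in\mathbb{R}^n,\ \|\mathbf{u}\|=1}\ \max_{\mathcal{S}\subset\mathcal{D},\ |\mathcal{S}|=k}\ \min_{\mathbf{d}\in\mathcal{S}}\frac{\mathbf{u}^\top\mathbf{d}}{\|\mathbf{d}\|},\qquad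 \mathrm{cm}(\mathcal{D})=\min_{\mathbf{u}\in\mathbb{R}^n,\ \|\mathbf{u}\|=1}\ \max_{\mathbf{d}\in\mathcal{D}}\frac{\mathbf{u}^\top\mathbf{d}}{\|\mathbf{d}\|}.$$
   Formalization: Properties (i)–(iii) are required for every numbering of each minimal positive basis, with some v for each (equivalently, one system v with d_i^T v_j < 0 for all j ≠ i); with the condition only for j < i in one numbering the positive k-basis claim is false. *)

theory Defs
  imports "HOL-Analysis.Analysis"
begin

text \<open>Finite families of vectors, repetitions allowed, are multisets; the union of families is
  their sum, which keeps multiplicities.\<close>

definition pspan :: "'a::real_vector multiset \<Rightarrow> 'a set" where
  "pspan D = {\<Sum>d\<in>set_mset D. c d *\<^sub>R d | c. \<forall>d\<in>#D. 0 \<le> c d}"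

definition positive_spanning_set :: "'a::real_vector set \<Rightarrow> 'a multiset \<Rightarrow> bool" where
  "positive_spanning_set L D \<longleftrightarrow> set_mset D \<subseteq> L \<and> 0 \<notin># D \<and> pspan D = L"

definition positive_basis :: "'a::real_vector set \<Rightarrow> 'a multiset \<Rightarrow> bool" where
  "positive_basis L D \<longleftrightarrow>
     positive_spanning_set L D \<and> (\<forall>d\<in>#D. pspan (D - {#d#}) \<noteq> L)"

definition minimal_positive_basis :: "'a::euclidean_space set \<Rightarrow> 'a multiset \<Rightarrow> bool" where
  "minimal_positive_basis L D \<longleftrightarrow> positive_basis L D \<and> size D = dim L + 1"

text \<open>The sum of the subspaces below is the Minkowski sum of sets.\<close>

definition ospb_decomposition ::
  "'a::euclidean_space multiset \<Rightarrow> nat \<Rightarrow> (nat \<Rightarrow> 'a set) \<Rightarrow> (nat \<Rightarrow> 'a multiset) \<Rightarrow> bool" where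
  "ospb_decomposition D s L DL \<longleftrightarrow>
     (\<forall>i\<in>{1..s}. subspace (L i)) \<and>
     (\<forall>i\<in>{1..s}. \<forall>j\<in>{1..s}. i \<noteq> j \<longrightarrow> (\<forall>x\<in>L i. \<forall>y\<in>L j. orthogonal x y)) \<and>
     (\<Sum>i\<in>{1..s}. L i) = UNIV \<and>
     (\<forall>i\<in>{1..s}. minimal_positive_basis (L i) (DL i)) \<and>
     D = (\<Sum>i\<in>{1..s}. DL i)"

definition ospb :: "'a::euclidean_space multiset \<Rightarrow> nat \<Rightarrow> bool" where
  "ospb D s \<longleftrightarrow>
     positive_basis UNIV D \<and> size D = DIM('a) + s \<and> (\<exists>L DL. ospb_decomposition D s L DL)"

definition orthogonal_projection :: "'a::euclidean_space set \<Rightarrow> 'a \<Rightarrow> 'a" where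
  "orthogonal_projection V x = (THE p. p \<in> V \<and> x - p \<in> orthogonal_comp V)"

definition vec_cos :: "'a::real_inner \<Rightarrow> 'a \<Rightarrow> real" where
  "vec_cos x y = (x \<bullet> y) / (norm x * norm y)"

definition separating_vectors ::
  "'a::euclidean_space set \<Rightarrow> (nat \<Rightarrow> 'a) \<Rightarrow> (nat \<Rightarrow> 'a) \<Rightarrow> bool" where
  "separating_vectors L d v \<longleftrightarrow>
     (\<forall>i\<in>{1..dim L + 1}. v i \<in> L) \<and>
     (\<forall>i\<in>{1..dim L + 1}. d i \<bullet> v i > 0) \<and>
     (\<forall>i j. 1 \<le> j \<and> j < i \<and> i \<le> dim L + 1 \<longrightarrow> d i \<bullet> v j < 0)"

text \<open>If a projection vanishes, the quotient is \<open>0 / 0 = 0\<close>. This is the right value: for a nonzero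
  projection \<open>p\<close> of \<open>x\<close> it equals \<open>norm p / norm x\<close>.\<close>

definition rho :: "'a::euclidean_space set \<Rightarrow> (nat \<Rightarrow> 'a) \<Rightarrow> (nat \<Rightarrow> 'a) \<Rightarrow> real" where
  "rho L d v =
     Max ((\<lambda>(i, i'). vec_cos (d i) (orthogonal_projection (L \<inter> orthogonal_comp {v i'}) (d i)))
          ` ({1..dim L + 1} \<times> {1..dim L + 1}))"

definition fixes_complement ::
  "(real^'n) set \<Rightarrow> nat \<Rightarrow> (nat \<Rightarrow> real^'n^'n) \<Rightarrow> bool" where
  "fixes_complement L k R \<longleftrightarrow> (\<forall>j\<in>{1..k}. \<forall>u\<in>orthogonal_comp L. R j *v u = u)"

definition distinct_directions ::
  "(real^'n) set \<Rightarrow> (nat \<Rightarrow> real^'n) \<Rightarrow> nat \<Rightarrow> (nat \<Rightarrow> real^'n^'n) \<Rightarrow> bool" where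
  "distinct_directions L d k R \<longleftrightarrow>
     (\<forall>j\<in>{1..k}. \<forall>j'\<in>{1..k}. \<forall>i\<in>{1..dim L + 1}. \<forall>i'\<in>{1..dim L + 1}.
        vec_cos (R j *v d i) (R j' *v d i') = 1 \<longleftrightarrow> j = j' \<and> i = i')"

definition close_to_original ::
  "(real^'n) set \<Rightarrow> (nat \<Rightarrow> real^'n) \<Rightarrow> real \<Rightarrow> nat \<Rightarrow> (nat \<Rightarrow> real^'n^'n) \<Rightarrow> bool" where
  "close_to_original L d r k R \<longleftrightarrow>
     (\<forall>i\<in>{1..dim L + 1}. \<forall>j\<in>{1..k}. vec_cos (R j *v d i) (d i) > r)"

text \<open>The family \<open>D\<close> is unordered, whereas the sign conditions on \<open>v\<close> (imposed for \<open>j < i\<close> only), and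
  hence \<open>rho\<close>, depend on how its members are numbered. The properties are properties of the family,
  so they are required for every numbering \<open>d\<close>, with some \<open>v\<close> for each of them. A single numbering
  would not suffice: in the plane, the unit vectors at 0, 95 and 190 degrees, numbered in this order,
  with \<open>v\<close> at -37.5, 47.5 and 227.5 degrees and rotations by 40 and -40 degrees satisfy all three
  properties, but the six rotated vectors still form a positive 2-spanning set after the one at
  55 degrees is removed.\<close>

definition rotation_properties ::
  "(real^'n) set \<Rightarrow> (real^'n) multiset \<Rightarrow> nat \<Rightarrow> (nat \<Rightarrow> real^'n^'n) \<Rightarrow> bool" where
  "rotation_properties L D k R \<longleftrightarrow>
     (\<forall>d. D = image_mset d (mset_set {1..dim L + 1}) \<longrightarrow>
        (\<exists>v. separating_vectors L d v \<and>
             fixes_complement L k R \<and>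
             distinct_directions L d k R \<and>
             close_to_original L d (rho L d v) k R))"

text \<open>The bound on the size of \<open>S\<close> is \<open>size S \<ge> size D - k + 1\<close> without truncated subtraction.\<close>

definition pspan_k :: "nat \<Rightarrow> 'a::real_vector multiset \<Rightarrow> 'a set" where
  "pspan_k k D = (\<Inter>S\<in>{S. S \<subseteq># D \<and> size D + 1 \<le> size S + k}. pspan S)"

definition positive_k_spanning_set :: "nat \<Rightarrow> 'a::real_vector multiset \<Rightarrow> bool" where
  "positive_k_spanning_set k D \<longleftrightarrow> pspan_k k D = UNIV"

definition positive_k_basis :: "nat \<Rightarrow> 'a::real_vector multiset \<Rightarrow> bool" where
  "positive_k_basis k D \<longleftrightarrow>
     positive_k_spanning_set k D \<and> (\<forall>d\<in>#D. pspan_k k (D - {#d#}) \<noteq> UNIV)"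

text \<open>The infima over the unit sphere are minima, see the two lemmas below.\<close>

definition cm_k :: "nat \<Rightarrow> 'a::euclidean_space multiset \<Rightarrow> real" where
  "cm_k k D =
     (INF u\<in>sphere 0 1. MAX S\<in>{S. S \<subseteq># D \<and> size S = k}. MIN d\<in>set_mset S. (u \<bullet> d) / norm d)"

definition cm :: "'a::euclidean_space multiset \<Rightarrow> real" where
  "cm D = (INF u\<in>sphere 0 1. MAX d\<in>set_mset D. (u \<bullet> d) / norm d)"

lemma continuous_on_MAX:
  fixes f :: "'b \<Rightarrow> 'a::topological_space \<Rightarrow> real"
  assumes "finite I" "I \<noteq> {}" "\<And>i. i \<in> I \<Longrightarrow> continuous_on A (f i)"
  shows "continuous_on A (\<lambda>u. MAX i\<in>I. f i u)"
  using assms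
proof (induction I rule: finite_ne_induct)
  case (insert x F)
  then have "continuous_on A (\<lambda>u. max (f x u) (MAX i\<in>F. f i u))"
    by (intro continuous_on_max) auto
  with insert show ?case by simp
qed simp

lemma continuous_on_MIN:
  fixes f :: "'b \<Rightarrow> 'a::topological_space \<Rightarrow> real"
  assumes "finite I" "I \<noteq> {}" "\<And>i. i \<in> I \<Longrightarrow> continuous_on A (f i)"
  shows "continuous_on A (\<lambda>u. MIN i\<in>I. f i u)"
  using assms
proof (induction I rule: finite_ne_induct)
  case (insert x F)
  then have "continuous_on A (\<lambda>u. min (f x u) (MIN i\<in>F. f i u))"
    by (intro continuous_on_min) auto
  with insert show ?case by simp
qed simp

lemma INF_sphere_attained:
  fixes f :: "'a::euclidean_space \<Rightarrow> real"
  assumes "continuous_on (sphere 0 1) f"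
  shows "\<exists>u\<in>sphere 0 1. (INF u\<in>sphere 0 1. f u) = f u \<and> (\<forall>w\<in>sphere 0 1. f u \<le> f w)"
proof -
  have "sphere (0::'a) 1 \<noteq> {}" by simp
  from continuous_attains_inf[OF compact_sphere this assms]
  obtain u where u: "u \<in> sphere 0 1" "\<forall>w\<in>sphere 0 1. f u \<le> f w" by blast
  then have "(INF u\<in>sphere 0 1. f u) = f u"
    by (intro cInf_eq_minimum) auto
  with u show ?thesis by blast
qed

lemma cm_attained:
  assumes "D \<noteq> {#}"
  shows "\<exists>u\<in>sphere 0 1. cm D = (MAX d\<in>set_mset D. (u \<bullet> d) / norm d) \<and>
           (\<forall>w\<in>sphere 0 1. cm D \<le> (MAX d\<in>set_mset D. (w \<bullet> d) / norm d))"
proof -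
  have "continuous_on (sphere 0 1) (\<lambda>u. MAX d\<in>set_mset D. (u \<bullet> d) / norm d)"
    using assms unfolding divide_inverse by (intro continuous_on_MAX continuous_intros) auto
  from INF_sphere_attained[OF this] show ?thesis unfolding cm_def by auto
qed

lemma cm_k_attained:
  assumes "1 \<le> k" "k \<le> size D"
  shows "\<exists>u\<in>sphere 0 1.
           cm_k k D = (MAX S\<in>{S. S \<subseteq># D \<and> size S = k}. MIN d\<in>set_mset S. (u \<bullet> d) / norm d) \<and>
           (\<forall>w\<in>sphere 0 1.
              cm_k k D \<le> (MAX S\<in>{S. S \<subseteq># D \<and> size S = k}. MIN d\<in>set_mset S. (w \<bullet> d) / norm d))"
proof -
  obtain xs where xs: "mset xs = D" using ex_mset by blast
  then have "mset (take k xs) \<subseteq># D"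
    by (metis append_take_drop_id mset_append mset_subset_eq_add_left)
  moreover have "size (mset (take k xs)) = k"
    using assms xs by auto
  ultimately have ne: "{S. S \<subseteq># D \<and> size S = k} \<noteq> {}" by blast
  have "finite (multisets_of_size (set_mset D) k)" by auto
  moreover have "{S. S \<subseteq># D \<and> size S = k} \<subseteq> multisets_of_size (set_mset D) k"
    by (auto simp: multisets_of_size_def dest: mset_subset_eqD)
  ultimately have fin: "finite {S. S \<subseteq># D \<and> size S = k}" by (rule rev_finite_subset)
  have "continuous_on (sphere 0 1)
     (\<lambda>u. MAX S\<in>{S. S \<subseteq># D \<and> size S = k}. MIN d\<in>set_mset S. (u \<bullet> d) / norm d)"
    using fin ne assms unfolding divide_inverse
    by (intro continuous_on_MAX continuous_on_MIN continuous_intros) auto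
  from INF_sphere_attained[OF this] show ?thesis unfolding cm_k_def by auto
qed

end

theory Submission
  imports Defs
begin

text \<open>The two halves of the result have different sources.

The spanning half and the bound on the cosine measure hold because each of the \<open>k\<close> layers of the
union is an isometric copy of the whole basis \<open>D\<close>. Indeed each rotation acts on its own subspace
and fixes the orthogonal complement, so the rotations of one layer glue to a single orthogonal
transformation of the space. Removing fewer than \<open>k\<close> vectors leaves one layer intact, and this
layer still spans positively. For the cosine measure, a unit vector has in each layer a neighbour
at cosine at least \<open>cm D\<close>, and these \<open>k\<close> neighbours are the \<open>k\<close>-element subfamily required.

No vector of the union can be dropped because each of them lies in an open half-space with only
\<open>k\<close> members of the union. Let the vector be a rotated copy of a member \<open>e\<close> of the \<open>m\<close>-th subbasis.
Number this subbasis so that \<open>e\<close> comes first. The first separating vector \<open>v\<close> then has a positive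
product with \<open>e\<close> and a negative one with all other members. The cosine of the angle between a member
and the hyperplane orthogonal to \<open>v\<close> is at most \<open>rho\<close>. The rotations move each member by an angle with
a larger cosine, hence by a smaller angle, and leave it on its side of the hyperplane. The other
subbases and their copies are orthogonal to \<open>v\<close>. Hence the vectors of the union with a positive
product with \<open>v\<close> are exactly the \<open>k\<close> copies of \<open>e\<close>. Dropping one of them allows the removal of the
other \<open>k - 1\<close>, which leaves a family in a closed half-space.\<close>

section \<open>Positive spans and half-spaces\<close>

lemma pspan_mono:
  assumes "set_mset A \<subseteq> set_mset B"
  shows "pspan A \<subseteq> pspan B"
proof
  fix x assume "x \<in> pspan A"
  then obtain c where c: "x = (\<Sum>d\<in>set_mset A. c d *\<^sub>R d)" "\<forall>d\<in>#A. 0 \<le> c d"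
    unfolding pspan_def by auto
  define c' where "c' d = (if d \<in># A then c d else 0)" for d
  have "(\<Sum>d\<in>set_mset B. c' d *\<^sub>R d) = x"
    unfolding c(1) by (rule sum.mono_neutral_cong_right) (use assms in \<open>auto simp: c'_def\<close>)
  moreover have "\<forall>d\<in>#B. 0 \<le> c' d"
    using c(2) by (auto simp: c'_def)
  ultimately show "x \<in> pspan B"
    unfolding pspan_def by blast
qed

lemma pspan_image_superset:
  assumes "linear f" "inj f"
  shows "f ` pspan A \<subseteq> pspan (image_mset f A)"
proof (rule image_subsetI)
  fix x assume "x \<in> pspan A"
  then obtain c where c: "x = (\<Sum>d\<in>set_mset A. c d *\<^sub>R d)" "\<forall>d\<in>#A. 0 \<le> c d"
    unfolding pspan_def by auto
  have inj_on: "inj_on f (set_mset A)"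
    using assms(2) by (rule inj_on_subset) simp
  have "f x = (\<Sum>d\<in>set_mset A. c (inv f (f d)) *\<^sub>R f d)"
    using assms by (simp add: c(1) linear_sum linear_cmul)
  also have "\<dots> = (\<Sum>e\<in>set_mset (image_mset f A). c (inv f e) *\<^sub>R e)"
    using inj_on by (simp add: sum.reindex)
  finally have "f x = (\<Sum>e\<in>set_mset (image_mset f A). c (inv f e) *\<^sub>R e)" .
  moreover have "\<forall>e\<in>#image_mset f A. 0 \<le> c (inv f e)"
    using c(2) assms(2) by auto
  ultimately show "f x \<in> pspan (image_mset f A)"
    unfolding pspan_def by (auto intro: exI[of _ "\<lambda>e. c (inv f e)"])
qed

lemma inner_le_0_if_in_pspan:
  fixes v :: "'a::real_inner"
  assumes "\<And>d. d \<in># S \<Longrightarrow> v \<bullet> d \<le> 0" "x \<in> pspan S"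
  shows "v \<bullet> x \<le> 0"
  using assms
  by (auto simp: pspan_def inner_sum_right intro!: sum_nonpos mult_nonneg_nonpos)

text \<open>After \<open>d\<close> has been dropped, the other members in the open half-space of \<open>v\<close> are few enough to be
  removed as well. What is left cannot produce \<open>v\<close> itself.\<close>

lemma pspan_k_remove_ne_UNIV:
  fixes v :: "'a::real_inner"
  assumes d: "d \<in># D" "v \<bullet> d > 0"
    and few: "size {#x \<in># D. v \<bullet> x > 0#} \<le> k"
  shows "pspan_k k (D - {#d#}) \<noteq> UNIV"
proof
  assume U: "pspan_k k (D - {#d#}) = UNIV"
  define S where "S = {#x \<in># D. \<not> v \<bullet> x > 0#}"
  have "S \<subseteq># D - {#d#}"
    using d(2) by (auto simp: S_def subseteq_mset_def)
  moreover have "size D = size {#x \<in># D. v \<bullet> x > 0#} + size S"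
    unfolding S_def by (metis multiset_partition size_union)
  with few d(1) have "size (D - {#d#}) + 1 \<le> size S + k"
    by (metis Suc_eq_plus1 add.commute add_le_cancel_left insert_DiffM size_add_mset)
  ultimately have "v \<in> pspan S"
    using U unfolding pspan_k_def by auto
  then have "v \<bullet> v \<le> 0"
    by (rule inner_le_0_if_in_pspan[rotated]) (auto simp: S_def)
  then have "v = 0"
    by (metis inner_eq_zero_iff inner_ge_zero order_antisym)
  with d(2) show False by simp
qed

section \<open>Unions of positive spanning sets\<close>

lemma filter_mset_sum:
  "filter_mset P (\<Sum>j\<in>J. F j) = (\<Sum>j\<in>J. filter_mset P (F j))"
  by (induction J rule: infinite_finite_induct) auto

text \<open>By the pigeonhole principle: if the support of a subfamily omits a vector of every \<open>F j\<close>, then all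
  copies of these vectors are missing, one or more for each \<open>j\<close>, even if the \<open>F j\<close> overlap. So at
  least \<open>card J\<close> members of the sum are missing.\<close>

lemma pspan_k_sum_eq_UNIV:
  assumes "finite J" "card J = k"
    and span: "\<And>j. j \<in> J \<Longrightarrow> pspan (F j) = UNIV"
  shows "pspan_k k (\<Sum>j\<in>J. F j) = UNIV"
proof -
  have "pspan S = UNIV"
    if S: "S \<subseteq># (\<Sum>j\<in>J. F j)" "size (\<Sum>j\<in>J. F j) + 1 \<le> size S + k" for S
  proof -
    define D where "D = (\<Sum>j\<in>J. F j)"
    have "\<exists>j\<in>J. set_mset (F j) \<subseteq> set_mset S"
    proof (rule ccontr)
      assume "\<not> ?thesis"
      then have "set_mset {#x \<in># F j. x \<notin># S#} \<noteq> {}" if "j \<in> J" for j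
        using that by auto
      then have "1 \<le> size {#x \<in># F j. x \<notin># S#}" if "j \<in> J" for j
        using that by (metis One_nat_def Suc_leI nonempty_has_size set_mset_eq_empty_iff)
      then have "(\<Sum>j\<in>J. 1) \<le> (\<Sum>j\<in>J. size {#x \<in># F j. x \<notin># S#})"
        by (intro sum_mono)
      then have "k \<le> size {#x \<in># D. x \<notin># S#}"
        using assms(2) by (simp add: D_def filter_mset_sum)
      also have "\<dots> \<le> size (D - S)"
        by (rule size_mset_mono) (auto simp: subseteq_mset_def not_in_iff)
      also have "\<dots> = size D - size S"
        using S(1) by (simp add: D_def size_Diff_submset)
      finally show False
        using S assms(2) size_mset_mono[OF S(1)] by (simp add: D_def)
    qed
    then show ?thesis
      using pspan_mono span by blast
  qed
  then show ?thesis
    by (auto simp: pspan_k_def)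
qed

lemma finite_submultisets_of_size:
  "finite {S. S \<subseteq># D \<and> size S = k}"
proof (rule finite_subset)
  show "{S. S \<subseteq># D \<and> size S = k} \<subseteq> multisets_of_size (set_mset D) k"
    by (auto simp: multisets_of_size_def dest: mset_subset_eqD)
qed auto

text \<open>One good vector chosen from each \<open>F j\<close> gives a good subfamily with \<open>card J\<close> members.\<close>

lemma cm_k_sum_ge:
  fixes F :: "'b \<Rightarrow> 'a::euclidean_space multiset"
  assumes "finite J" "card J = k" "1 \<le> k"
    and near: "\<And>j u. j \<in> J \<Longrightarrow> norm u = 1 \<Longrightarrow> \<exists>d\<in>#F j. c \<le> (u \<bullet> d) / norm d"
  shows "c \<le> cm_k k (\<Sum>j\<in>J. F j)"
proof -
  define D where "D = (\<Sum>j\<in>J. F j)"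
  have sub: "\<exists>S. S \<subseteq># D \<and> size S = k \<and> (\<forall>d\<in>#S. c \<le> (u \<bullet> d) / norm d)" if u1: "norm u = 1" for u
  proof -
    obtain g where g: "\<And>j. j \<in> J \<Longrightarrow> g j \<in># F j \<and> c \<le> (u \<bullet> g j) / norm (g j)"
      using near[OF _ u1] by metis
    have "(\<Sum>j\<in>I. {#g j#}) \<subseteq># (\<Sum>j\<in>I. F j)" if "finite I" "I \<subseteq> J" for I
      using that
    proof (induction I)
      case (insert a I)
      then have "{#g a#} + (\<Sum>j\<in>I. {#g j#}) \<subseteq># F a + (\<Sum>j\<in>I. F j)"
        using g[of a] by (intro subset_mset.add_mono) auto
      with insert.hyps show ?case by simp
    qed simp
    with assms(1,2) g show ?thesis
      by (intro exI[of _ "\<Sum>j\<in>J. {#g j#}"]) (auto simp: D_def set_mset_sum)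
  qed
  obtain w :: 'a where "norm w = 1"
    using vector_choose_size[of 1] by auto
  then have "k \<le> size D"
    using sub size_mset_mono by metis
  from cm_k_attained[OF assms(3) this] obtain u where u: "norm u = 1"
    and cm: "cm_k k D = (MAX S\<in>{S. S \<subseteq># D \<and> size S = k}. MIN d\<in>set_mset S. (u \<bullet> d) / norm d)"
    by auto
  obtain S where S: "S \<subseteq># D" "size S = k" "\<forall>d\<in>#S. c \<le> (u \<bullet> d) / norm d"
    using sub[OF u] by auto
  have "S \<noteq> {#}"
    using S(2) assms(3) by auto
  then have "c \<le> (MIN d\<in>set_mset S. (u \<bullet> d) / norm d)"
    using S(3) by simp
  also have "\<dots> \<le> cm_k k D"
    unfolding cm by (rule Max_ge) (use S finite_submultisets_of_size in auto)
  finally show ?thesis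
    by (simp add: D_def)
qed

section \<open>Isometric copies of a family\<close>

lemma pspan_orthogonal_image_eq_UNIV:
  fixes Q :: "'a::euclidean_space \<Rightarrow> 'a"
  assumes "orthogonal_transformation Q" "pspan D = UNIV"
  shows "pspan (image_mset Q D) = UNIV"
  using pspan_image_superset[of Q D] assms
  by (auto simp: orthogonal_transformation_linear orthogonal_transformation_inj
      orthogonal_transformation_surj)

lemma cm_le_orthogonal_image:
  fixes Q :: "'a::euclidean_space \<Rightarrow> 'a"
  assumes Q: "orthogonal_transformation Q" and "D \<noteq> {#}" "norm u = 1"
  shows "\<exists>d\<in>#image_mset Q D. cm D \<le> (u \<bullet> d) / norm d"
proof -
  obtain w where w: "u = Q w"
    using orthogonal_transformation_surj[OF Q] by (metis surjD)
  then have "norm w = 1"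
    using assms by (simp add: orthogonal_transformation)
  then have "cm D \<le> (MAX d\<in>set_mset D. (w \<bullet> d) / norm d)"
    using cm_attained[OF assms(2)] by auto
  moreover have "(MAX d\<in>set_mset D. (w \<bullet> d) / norm d) \<in> (\<lambda>d. (w \<bullet> d) / norm d) ` set_mset D"
    using assms(2) by (intro Max_in) auto
  ultimately obtain d where "d \<in># D" "cm D \<le> (w \<bullet> d) / norm d"
    by auto
  then show ?thesis
    using Q by (auto simp: w orthogonal_transformation_def norm_eq_sqrt_inner)
qed

text \<open>A transformation that fixes the complement of \<open>L\<close> also respects \<open>L\<close>, since it preserves
  orthogonality to the complement.\<close>

lemma orthogonal_transformation_preserves:
  fixes f :: "'a::euclidean_space \<Rightarrow> 'a"
  assumes f: "orthogonal_transformation f" and "subspace L"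
    and fix': "\<And>u. u \<in> orthogonal_comp L \<Longrightarrow> f u = u" and "x \<in> L"
  shows "f x \<in> L"
proof -
  have "u \<bullet> f x = 0" if "u \<in> orthogonal_comp L" for u
  proof -
    have "u \<bullet> f x = f u \<bullet> f x"
      using fix'[OF that] by simp
    also have "\<dots> = u \<bullet> x"
      using f by (simp add: orthogonal_transformation_def)
    also have "\<dots> = 0"
      using that assms(4) by (auto simp: orthogonal_comp_def orthogonal_def inner_commute)
    finally show ?thesis .
  qed
  then have "f x \<in> orthogonal_comp (orthogonal_comp L)"
    by (auto simp: orthogonal_comp_def orthogonal_def inner_commute)
  then show ?thesis
    using orthogonal_comp_self[OF assms(2)] by simp
qed

text \<open>The gluing map is the composition of all \<open>f i\<close>: on a vector of \<open>L i\<close> only the factor \<open>f i\<close>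
  has an effect. The induction keeps track of the subspaces not yet moved.\<close>

lemma glue_orthogonal_transformations:
  fixes f :: "'i \<Rightarrow> 'a::euclidean_space \<Rightarrow> 'a"
  assumes "finite I"
    and orth: "\<And>i. i \<in> I \<Longrightarrow> orthogonal_transformation (f i)"
    and pres: "\<And>i x. i \<in> I \<Longrightarrow> x \<in> L i \<Longrightarrow> f i x \<in> L i"
    and fix': "\<And>i j x. i \<in> I \<Longrightarrow> j \<in> I \<Longrightarrow> i \<noteq> j \<Longrightarrow> x \<in> L j \<Longrightarrow> f i x = x"
  obtains Q where "orthogonal_transformation Q" "\<And>i x. i \<in> I \<Longrightarrow> x \<in> L i \<Longrightarrow> Q x = f i x"
proof -
  have "\<exists>Q. orthogonal_transformation Q \<and> (\<forall>i\<in>J. \<forall>x\<in>L i. Q x = f i x) \<and>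
            (\<forall>i\<in>I - J. \<forall>x\<in>L i. Q x = x)" if "finite J" "J \<subseteq> I" for J
    using that
  proof (induction J)
    case empty
    show ?case by (rule exI[of _ "\<lambda>x. x"]) auto
  next
    case (insert a J)
    then obtain Q where Q: "orthogonal_transformation Q" "\<forall>i\<in>J. \<forall>x\<in>L i. Q x = f i x"
      "\<forall>i\<in>I - J. \<forall>x\<in>L i. Q x = x" by auto
    have "orthogonal_transformation (f a \<circ> Q)"
      using orth[of a] Q(1) insert.prems
      by (auto simp: orthogonal_transformation_def intro: linear_compose)
    moreover have "(f a \<circ> Q) x = f i x" if "i \<in> insert a J" "x \<in> L i" for i x
    proof (cases "i = a")
      case True
      with that Q(3) insert show ?thesis by auto
    next
      case False
      with that have "Q x = f i x"
        using Q(2) by auto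
      moreover have "f a (f i x) = f i x"
        using that False insert.prems by (intro fix'[of a i] pres) auto
      ultimately show ?thesis by simp
    qed
    moreover have "(f a \<circ> Q) x = x" if "i \<in> I - insert a J" "x \<in> L i" for i x
      using that Q(3) fix'[of a i x] insert.prems by auto
    ultimately show ?case by blast
  qed
  from this[OF assms(1) subset_refl] that show thesis by auto
qed

section \<open>Rotations by less than the angle to a hyperplane\<close>

text \<open>Since both vectors lie in \<open>L\<close>, projecting on the trace of the hyperplane in \<open>L\<close> is the same as
  projecting on the hyperplane itself.\<close>

lemma orthogonal_projection_hyperplane:
  fixes L :: "'a::euclidean_space set"
  assumes L: "subspace L" and "x \<in> L" "v \<in> L"
  shows "orthogonal_projection (L \<inter> orthogonal_comp {v}) x = x - ((x \<bullet> v) / (v \<bullet> v)) *\<^sub>R v"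
    (is "orthogonal_projection ?V x = ?p")
  unfolding orthogonal_projection_def
proof (rule the_equality)
  have "?p \<in> L"
    using assms by (simp add: subspace_diff subspace_scale)
  moreover have "v \<bullet> ?p = 0"
    by (simp add: inner_diff_right inner_commute)
  ultimately have "?p \<in> ?V"
    by (simp add: orthogonal_comp_def orthogonal_def)
  moreover have comp: "x - ?p \<in> orthogonal_comp ?V"
    by (auto simp: orthogonal_comp_def orthogonal_def inner_commute)
  ultimately show p: "?p \<in> ?V \<and> x - ?p \<in> orthogonal_comp ?V" by simp
  fix q assume q: "q \<in> ?V \<and> x - q \<in> orthogonal_comp ?V"
  have sub: "subspace ?V"
    using L by (intro subspace_inter subspace_orthogonal_comp)
  then have "?p - q \<in> ?V"
    using p q subspace_diff by blast
  moreover have "(x - q) - (x - ?p) \<in> orthogonal_comp ?V"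
    using p q subspace_diff[OF subspace_orthogonal_comp] by blast
  then have "?p - q \<in> orthogonal_comp ?V"
    by (simp add: algebra_simps)
  ultimately have "(?p - q) \<bullet> (?p - q) = 0"
    by (auto simp: orthogonal_comp_def orthogonal_def)
  then show "q = ?p" by simp
qed

text \<open>If \<open>w\<close> is on the other side of the hyperplane orthogonal to \<open>v\<close>, or on it, then the component
  of \<open>x\<close> along \<open>v\<close> contributes nothing positive to \<open>w \<bullet> x\<close>. So \<open>w\<close> cannot be closer in angle to \<open>x\<close>
  than the projection of \<open>x\<close> on the hyperplane.\<close>

lemma vec_cos_le_projection_if_separated:
  fixes L :: "'a::euclidean_space set"
  assumes "subspace L" "x \<in> L" "v \<in> L" and sep: "(x \<bullet> v) * (w \<bullet> v) \<le> 0"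
  shows "vec_cos w x \<le> vec_cos x (orthogonal_projection (L \<inter> orthogonal_comp {v}) x)"
proof -
  define p where "p = x - ((x \<bullet> v) / (v \<bullet> v)) *\<^sub>R v"
  have proj: "orthogonal_projection (L \<inter> orthogonal_comp {v}) x = p"
    unfolding p_def by (rule orthogonal_projection_hyperplane) fact+
  have x: "x = p + ((x \<bullet> v) / (v \<bullet> v)) *\<^sub>R v"
    by (simp add: p_def)
  have "v \<bullet> p = 0"
    by (simp add: p_def inner_diff_right inner_commute)
  then have "x \<bullet> p = p \<bullet> p"
    by (subst x) (simp add: inner_add_left)
  then have cos: "vec_cos x p = norm p / norm x"
    by (simp add: vec_cos_def dot_square_norm power2_eq_square)
  have "w \<bullet> x = w \<bullet> p + ((x \<bullet> v) * (w \<bullet> v)) / (v \<bullet> v)"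
    by (subst x) (simp add: inner_add_right)
  also have "\<dots> \<le> w \<bullet> p"
    using sep by (simp add: divide_nonpos_nonneg)
  also have "\<dots> \<le> norm w * norm p"
    by (rule norm_cauchy_schwarz)
  finally have "(w \<bullet> x) / (norm w * norm x) \<le> (norm w * norm p) / (norm w * norm x)"
    by (rule divide_right_mono) simp
  also have "\<dots> \<le> norm p / norm x"
    by (cases "w = 0") auto
  finally show ?thesis
    unfolding proj cos by (simp add: vec_cos_def)
qed

lemma same_side_if_close_to_original:
  fixes L :: "(real^'n) set"
  assumes "subspace L" and d: "d i \<in> L" and v: "separating_vectors L d v"
    and close: "close_to_original L d (rho L d v) k R"
    and i: "i \<in> {1..dim L + 1}" "i' \<in> {1..dim L + 1}" "j \<in> {1..k}"
  shows "(d i \<bullet> v i') * ((R j *v d i) \<bullet> v i') > 0"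
proof (rule ccontr)
  assume "\<not> ?thesis"
  moreover have "v i' \<in> L"
    using v i(2) by (auto simp: separating_vectors_def)
  ultimately have "vec_cos (R j *v d i) (d i)
      \<le> vec_cos (d i) (orthogonal_projection (L \<inter> orthogonal_comp {v i'}) (d i))"
    using assms(1) d by (intro vec_cos_le_projection_if_separated) auto
  also have "\<dots> \<le> rho L d v"
    unfolding rho_def by (rule Max_ge) (use i in auto)
  finally show False
    using close i by (force simp: close_to_original_def)
qed

section \<open>Rotated copies of a minimal positive basis\<close>

lemma enumeration_starting_with:
  assumes "e \<in># D" "size D = n"
  obtains d where "D = image_mset d (mset_set {1..n})" "d 1 = e"
proof -
  obtain xs where xs: "mset xs = D - {#e#}"
    using ex_mset by blast
  define ys where "ys = e # xs"
  have D: "mset ys = D"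
    using assms(1) xs by (simp add: ys_def)
  then have len: "length ys = n"
    using assms(2) by (metis size_mset)
  have "mset ys = mset (map (nth ys) [0..<n])"
    using len by (metis map_nth)
  also have "\<dots> = image_mset (nth ys) (mset_set {0..<n})"
    by simp
  also have "mset_set {0..<n} = image_mset (\<lambda>i. i - 1) (mset_set {1..n})"
  proof -
    have "(\<lambda>i. i - 1) ` {1..n} = {0..<n}"
    proof (intro equalityI subsetI)
      fix x assume "x \<in> {0..<n}"
      then show "x \<in> (\<lambda>i. i - 1) ` {1..n}"
        by (intro image_eqI[of _ _ "Suc x"]) auto
    qed auto
    moreover have "inj_on (\<lambda>i. i - 1) {1..n}"
      by (auto simp: inj_on_def)
    ultimately show ?thesis
      by (metis image_mset_mset_set)
  qed
  finally have "D = image_mset (\<lambda>i. ys ! (i - 1)) (mset_set {1..n})"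
    using D by (simp add: image_mset.compositionality comp_def)
  then show thesis
    by (rule that) (simp add: ys_def)
qed

text \<open>Only the first separating vector has prescribed signs against all vectors of the numbering,
  so \<open>e\<close> has to be numbered first.\<close>

lemma half_space_isolating_rotations:
  fixes L :: "(real^'n) set"
  assumes "subspace L" "minimal_positive_basis L B" "rotation_properties L B k R" "e \<in># B"
  obtains v where "v \<in> L"
    "\<And>j. j \<in> {1..k} \<Longrightarrow> v \<bullet> (R j *v e) > 0"
    "\<And>j. j \<in> {1..k} \<Longrightarrow> size {#x \<in># image_mset (\<lambda>d. R j *v d) B. v \<bullet> x > 0#} = 1"
proof -
  have "size B = dim L + 1"
    using assms(2) by (simp add: minimal_positive_basis_def)
  then obtain d where d: "B = image_mset d (mset_set {1..dim L + 1})" "d 1 = e"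
    using enumeration_starting_with[OF assms(4)] by blast
  then obtain v where v: "separating_vectors L d v"
    and close: "close_to_original L d (rho L d v) k R"
    using assms(3) unfolding rotation_properties_def by blast
  have "set_mset B \<subseteq> L"
    using assms(2) by (simp add: minimal_positive_basis_def positive_basis_def positive_spanning_set_def)
  then have dL: "d i \<in> L" if "i \<in> {1..dim L + 1}" for i
    using that d(1) by auto
  have side: "(d i \<bullet> v 1) * ((R j *v d i) \<bullet> v 1) > 0"
    if "i \<in> {1..dim L + 1}" "j \<in> {1..k}" for i j
    using assms(1) v close that dL by (intro same_side_if_close_to_original) auto
  have pos: "v 1 \<bullet> (R j *v d i) > 0 \<longleftrightarrow> i = 1" if ij: "i \<in> {1..dim L + 1}" "j \<in> {1..k}" for i j
  proof (cases "i = 1")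
    case True
    have "d i \<bullet> v 1 > 0"
      using v ij True by (auto simp: separating_vectors_def)
    with True side[OF ij] show ?thesis
      by (simp add: zero_less_mult_iff inner_commute)
  next
    case False
    then have "d i \<bullet> v 1 < 0"
      using v ij by (auto simp: separating_vectors_def)
    with False side[OF ij] show ?thesis
      by (simp add: zero_less_mult_iff inner_commute)
  qed
  show thesis
  proof (rule that[of "v 1"])
    show "v 1 \<in> L"
      using v by (auto simp: separating_vectors_def)
    fix j assume j: "j \<in> {1..k}"
    show "v 1 \<bullet> (R j *v e) > 0"
      using pos[of 1 j] j d(2) by auto
    have "{i \<in> {1..dim L + 1}. v 1 \<bullet> (R j *v d i) > 0} = {1}"
      using pos j by auto
    then show "size {#x \<in># image_mset (\<lambda>d. R j *v d) B. v 1 \<bullet> x > 0#} = 1"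
      by (simp add: d(1) filter_mset_image_mset image_mset.compositionality comp_def)
  qed
qed

section \<open>The union of the rotated bases\<close>

theorem corollary4p1:
  fixes D :: "(real^'n) multiset"
    and L :: "nat \<Rightarrow> (real^'n) set"
    and DL :: "nat \<Rightarrow> (real^'n) multiset"
    and R :: "nat \<Rightarrow> nat \<Rightarrow> real^'n^'n"
    and s k :: nat
  assumes "2 \<le> CARD('n)"
    and "ospb D s"
    and "ospb_decomposition D s L DL"
    and "\<And>i. i \<in> {1..s} \<Longrightarrow> 1 < dim (L i)"
    and "1 \<le> k"
    and "\<And>i j. i \<in> {1..s} \<Longrightarrow> j \<in> {1..k} \<Longrightarrow> rotation_matrix (R i j)"
    and "\<And>i. i \<in> {1..s} \<Longrightarrow> rotation_properties (L i) (DL i) k (R i)"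
  shows "positive_k_basis k (\<Sum>j\<in>{1..k}. \<Sum>i\<in>{1..s}. image_mset (\<lambda>d. R i j *v d) (DL i)) \<and>
         cm_k k (\<Sum>j\<in>{1..k}. \<Sum>i\<in>{1..s}. image_mset (\<lambda>d. R i j *v d) (DL i)) \<ge> cm D"
proof -
  define F where "F j = (\<Sum>i\<in>{1..s}. image_mset (\<lambda>d. R i j *v d) (DL i))" for j
  have D: "D = (\<Sum>i\<in>{1..s}. DL i)" and L: "\<And>i. i \<in> {1..s} \<Longrightarrow> subspace (L i)"
    and min: "\<And>i. i \<in> {1..s} \<Longrightarrow> minimal_positive_basis (L i) (DL i)"
    and perp: "\<And>i j x y. i \<in> {1..s} \<Longrightarrow> j \<in> {1..s} \<Longrightarrow> i \<noteq> j \<Longrightarrow> x \<in> L i \<Longrightarrow> y \<in> L j \<Longrightarrow> x \<bullet> y = 0"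
    using assms(3) by (auto simp: ospb_decomposition_def orthogonal_def)
  have DL: "x \<in> L i" if "i \<in> {1..s}" "x \<in># DL i" for i x
    using min[OF that(1)] that(2)
    by (auto simp: minimal_positive_basis_def positive_basis_def positive_spanning_set_def)
  have D_span: "pspan D = UNIV" and D_ne: "D \<noteq> {#}"
    using assms(2) by (auto simp: ospb_def positive_basis_def positive_spanning_set_def)
  have orth: "orthogonal_transformation ((*v) (R i j))" if "i \<in> {1..s}" "j \<in> {1..k}" for i j
    using assms(6)[OF that]
    by (simp add: rotation_matrix_def orthogonal_transformation_matrix)
  have fix_comp: "R i j *v u = u"
    if i: "i \<in> {1..s}" and j: "j \<in> {1..k}" and u: "u \<in> orthogonal_comp (L i)" for i j u
  proof -
    have "size (DL i) = dim (L i) + 1"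
      using min[OF i] by (simp add: minimal_positive_basis_def)
    then obtain e where "e \<in># DL i"
      by (metis Suc_eq_plus1 size_eq_Suc_imp_elem)
    \<comment> \<open>The properties of the rotations are conditional on a numbering, so one has to be exhibited.\<close>
    then obtain d where "DL i = image_mset d (mset_set {1..dim (L i) + 1})"
      using enumeration_starting_with[OF _ \<open>size (DL i) = dim (L i) + 1\<close>] by blast
    then show ?thesis
      using assms(7)[OF i] j u
      unfolding rotation_properties_def fixes_complement_def by blast
  qed
  have fix_other: "R i j *v x = x"
    if "i \<in> {1..s}" "j \<in> {1..k}" "m \<in> {1..s}" "m \<noteq> i" "x \<in> L m" for i j m x
    using that perp[of i m] by (intro fix_comp) (auto simp: orthogonal_comp_def orthogonal_def)
  have pres: "R i j *v x \<in> L i" if "i \<in> {1..s}" "j \<in> {1..k}" "x \<in> L i" for i j x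
    by (rule orthogonal_transformation_preserves
        [OF orth[OF that(1,2)] L[OF that(1)] fix_comp[OF that(1,2)] that(3)])

  have copy: "\<exists>Q. orthogonal_transformation Q \<and> F j = image_mset Q D" if j: "j \<in> {1..k}" for j
  proof -
    obtain Q where Q: "orthogonal_transformation Q"
      "\<And>i x. i \<in> {1..s} \<Longrightarrow> x \<in> L i \<Longrightarrow> Q x = R i j *v x"
      by (rule glue_orthogonal_transformations[of "{1..s}" "\<lambda>i. (*v) (R i j)" L])
        (use orth[OF _ j] pres[OF _ j] fix_other[OF _ j] in blast)+
    have "image_mset Q (\<Sum>i\<in>I. DL i) = (\<Sum>i\<in>I. image_mset Q (DL i))" for I
      by (induction I rule: infinite_finite_induct) auto
    then have "image_mset Q D = (\<Sum>i\<in>{1..s}. image_mset Q (DL i))"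
      by (simp add: D)
    also have "\<dots> = F j"
      unfolding F_def using Q(2) DL by (intro sum.cong image_mset_cong) auto
    finally show ?thesis
      using Q(1) by auto
  qed

  have "pspan_k k (\<Sum>j\<in>{1..k}. F j) = UNIV"
  proof (rule pspan_k_sum_eq_UNIV)
    show "pspan (F j) = UNIV" if "j \<in> {1..k}" for j
      using copy[OF that] pspan_orthogonal_image_eq_UNIV D_span by metis
  qed auto

  moreover have "pspan_k k ((\<Sum>j\<in>{1..k}. F j) - {#d0#}) \<noteq> UNIV" if d0: "d0 \<in># (\<Sum>j\<in>{1..k}. F j)" for d0
  proof -
    obtain m j0 e where m: "m \<in> {1..s}" and j0: "j0 \<in> {1..k}" and e: "e \<in># DL m" "d0 = R m j0 *v e"
      using d0 by (auto simp: F_def set_mset_sum)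
    obtain v where v: "v \<in> L m" "\<And>j. j \<in> {1..k} \<Longrightarrow> v \<bullet> (R m j *v e) > 0"
      "\<And>j. j \<in> {1..k} \<Longrightarrow> size {#x \<in># image_mset (\<lambda>d. R m j *v d) (DL m). v \<bullet> x > 0#} = 1"
      using half_space_isolating_rotations[OF L[OF m] min[OF m] assms(7)[OF m] e(1)] by blast
    have "size {#x \<in># image_mset (\<lambda>d. R i j *v d) (DL i). v \<bullet> x > 0#} = (if i = m then 1 else 0)"
      if "i \<in> {1..s}" "j \<in> {1..k}" for i j
    proof (cases "i = m")
      case False
      have "v \<bullet> (R i j *v d) = 0" if "d \<in># DL i" for d
        using perp[of m i v "R i j *v d"] pres DL v(1) m False that \<open>i \<in> {1..s}\<close> \<open>j \<in> {1..k}\<close> by auto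
      then have "{#x \<in># image_mset (\<lambda>d. R i j *v d) (DL i). v \<bullet> x > 0#} = {#}"
        by (auto simp flip: set_mset_eq_empty_iff)
      with False show ?thesis by simp
    qed (use v(3) that in auto)
    then have "size {#x \<in># (\<Sum>j\<in>{1..k}. F j). v \<bullet> x > 0#}
        = (\<Sum>j\<in>{1..k}. \<Sum>i\<in>{1..s}. if i = m then 1 else 0)"
      unfolding F_def filter_mset_sum size_multiset_sum by (intro sum.cong refl) auto
    also have "\<dots> = k"
      using m by simp
    finally show ?thesis
      using d0 v(2)[OF j0] by (intro pspan_k_remove_ne_UNIV[where v = v]) (auto simp: e(2))
  qed

  moreover have "cm D \<le> cm_k k (\<Sum>j\<in>{1..k}. F j)"
  proof (rule cm_k_sum_ge)
    show "\<exists>d\<in>#F j. cm D \<le> (u \<bullet> d) / norm d" if "j \<in> {1..k}" "norm u = 1" for j u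
      using copy[OF that(1)] cm_le_orthogonal_image[OF _ D_ne that(2)] by metis
  qed (use assms(5) in auto)

  ultimately show ?thesis
    by (simp add: positive_k_basis_def positive_k_spanning_set_def F_def)
qed

end
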